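(* Under unilateral link formation with the simple-minded adversary, for all integers $n\ge 3$, all $\alpha>0$, and every Nash equilibrium $S$ for $n$ players and link cost $\alpha$, $$\frac{C(S)}{\mathrm{OPT}(n,\alpha)}\;\le\;10+\frac{10}{n-1}\;=\;10+o(1)\quad(n\to\infty),$$ i.e. the price of anarchy is at most $10+\frac{10}{n-1}$.
   Context: Players are $V=\{1,\dots,n\}$ ($n\ge 3$), link cost is $\alpha>0$. A strategy profile is a matrix $S\in\{0,1\}^{n\times n}$ with $S_{vv}=0$; for $v\ne w$, $S_{vw}=1$ means that player $v$ requests the edge $\{v,w\}$. Unilateral link formation: the final graph is the simple undirected graph $G(S)=(V,E(S))$ with $E(S)=\{\{v,w\}: S_{vw}=1 \text{ or } S_{wv}=1\}$. Only essential profiles are considered ($S_{vw}=1\Rightarrow S_{wv}=0$). For a connected graph $G=(V,E)$, $e\in E$, $v\in V$, the relevance $\mathrm{rel}_G(e,v)$ is the number of vertices that, starting at $v$, can only be reached via $e$ (so it is $0$ iff $e$ is not a bridge). The simple-minded adversary removes one edge chosen uniformly at random; so the disconnection cost of $v$ is $I_v(G)=\frac{1}{|E|}\sum_{e\in E}\mathrm{rel}_G(e,v)$ if $G$ is connected and $I_v(G)=\infty$ otherwise. Individual cost: $C_v(S)=\alpha\sum_{w}S_{vw}+I_v(G(S))$. Social cost: $C(S)=\sum_{v\in V}C_v(S)$. $\mathrm{OPT}(n,\alpha)$ is the minimum of $C(S)$ over all strategy profiles. $S$ is a Nash equilibrium if no player $v$ can strictly decrease $C_v$ by changing her own row $S_v$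 (arbitrarily) while the other rows stay fixed. The price of anarchy is the maximum of $C(S)/\mathrm{OPT}(n,\alpha)$ over Nash equilibria $S$. *)

theory Defs
  imports Complex_Main "HOL-Library.Extended_Real" "HOL-Library.Landau_Symbols"
begin

definition players :: "nat \<Rightarrow> nat set" where
  "players n = {1..n}"

text \<open>A strategy profile is an \<open>n \<times> n\<close> matrix over \<open>{0, 1}\<close> with zero diagonal, encoded as a
  function on all pairs of naturals that vanishes outside \<open>players n \<times> players n\<close>. This makes
  profiles correspond one-to-one to such matrices, so that there are only finitely many.\<close>

definition strategy_profile :: "nat \<Rightarrow> (nat \<Rightarrow> nat \<Rightarrow> nat) \<Rightarrow> bool" where
  "strategy_profile n S \<longleftrightarrow>
     (\<forall>v w. S v w \<in> {0, 1}) \<and>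
     (\<forall>v. S v v = 0) \<and>
     (\<forall>v w. v \<notin> players n \<or> w \<notin> players n \<longrightarrow> S v w = 0)"

definition essential :: "(nat \<Rightarrow> nat \<Rightarrow> nat) \<Rightarrow> bool" where
  "essential S \<longleftrightarrow> (\<forall>v w. S v w = 1 \<longrightarrow> S w v = 0)"

definition final_edges :: "nat \<Rightarrow> (nat \<Rightarrow> nat \<Rightarrow> nat) \<Rightarrow> nat set set" where
  "final_edges n S =
     {{v, w} | v w. v \<in> players n \<and> w \<in> players n \<and> (S v w = 1 \<or> S w v = 1)}"

definition walk_betw :: "'v set \<Rightarrow> 'v set set \<Rightarrow> 'v \<Rightarrow> 'v list \<Rightarrow> 'v \<Rightarrow> bool" where
  "walk_betw V E v p w \<longleftrightarrow>
     p \<noteq> [] \<and> hd p = v \<and> last p = w \<and> set p \<subseteq> V \<and> successively (\<lambda>x y. {x, y} \<in> E) p"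

definition walk_edges :: "'v list \<Rightarrow> 'v set set" where
  "walk_edges p = {{p ! i, p ! Suc i} | i. Suc i < length p}"

definition connected_graph :: "'v set \<Rightarrow> 'v set set \<Rightarrow> bool" where
  "connected_graph V E \<longleftrightarrow> (\<forall>v\<in>V. \<forall>w\<in>V. \<exists>p. walk_betw V E v p w)"

text \<open>The vertices that can be reached from \<open>v\<close> only via \<open>e\<close>: every walk from \<open>v\<close> to such a
  vertex traverses \<open>e\<close>. Only used for connected graphs, where at least one walk exists.\<close>

definition relevance :: "'v set \<Rightarrow> 'v set set \<Rightarrow> 'v set \<Rightarrow> 'v \<Rightarrow> nat" where
  "relevance V E e v = card {w \<in> V. \<forall>p. walk_betw V E v p w \<longrightarrow> e \<in> walk_edges p}"

definition disconnection_cost :: "'v set \<Rightarrow> 'v set set \<Rightarrow> 'v \<Rightarrow> ereal" where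
  "disconnection_cost V E v =
     (if connected_graph V E
      then ereal (1 / real (card E) * (\<Sum>e\<in>E. real (relevance V E e v)))
      else \<infinity>)"

definition individual_cost :: "nat \<Rightarrow> real \<Rightarrow> (nat \<Rightarrow> nat \<Rightarrow> nat) \<Rightarrow> nat \<Rightarrow> ereal" where
  "individual_cost n \<alpha> S v =
     ereal (\<alpha> * (\<Sum>w\<in>players n. real (S v w)))
       + disconnection_cost (players n) (final_edges n S) v"

definition social_cost :: "nat \<Rightarrow> real \<Rightarrow> (nat \<Rightarrow> nat \<Rightarrow> nat) \<Rightarrow> ereal" where
  "social_cost n \<alpha> S = (\<Sum>v\<in>players n. individual_cost n \<alpha> S v)"

definition OPT :: "nat \<Rightarrow> real \<Rightarrow> ereal" where
  "OPT n \<alpha> = Min (social_cost n \<alpha> ` {S. strategy_profile n S})"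

text \<open>Deviations are arbitrary new rows; the profile after a deviation need not be essential.\<close>

definition nash_equilibrium :: "nat \<Rightarrow> real \<Rightarrow> (nat \<Rightarrow> nat \<Rightarrow> nat) \<Rightarrow> bool" where
  "nash_equilibrium n \<alpha> S \<longleftrightarrow>
     strategy_profile n S \<and>
     (\<forall>v\<in>players n. \<forall>r. strategy_profile n (S(v := r)) \<longrightarrow>
        \<not> individual_cost n \<alpha> (S(v := r)) v < individual_cost n \<alpha> S v)"

text \<open>The supremum is a maximum whenever an equilibrium exists, as there are finitely many
  profiles.\<close>

definition price_of_anarchy :: "nat \<Rightarrow> real \<Rightarrow> ereal" where
  "price_of_anarchy n \<alpha> =
     (SUP S \<in> {S. nash_equilibrium n \<alpha> S \<and> essential S}. social_cost n \<alpha> S / OPT n \<alpha>)"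

text \<open>The minimum in the definition of \<open>OPT\<close> is over a finite nonempty set.\<close>

lemma finite_strategy_profiles: "finite {S. strategy_profile n S}"
proof -
  let ?f = "\<lambda>A v w. if (v, w) \<in> A then 1 else (0::nat)"
  have "S \<in> ?f ` Pow (players n \<times> players n)" if "strategy_profile n S" for S
  proof
    show "S = ?f {(v, w). S v w = 1}"
      using that by (intro ext) (auto simp: strategy_profile_def)
    show "{(v, w). S v w = 1} \<in> Pow (players n \<times> players n)"
    proof (rule PowI, rule subrelI)
      fix v w assume "(v, w) \<in> {(v, w). S v w = 1}"
      then have "S v w \<noteq> 0" by simp
      with that show "(v, w) \<in> players n \<times> players n"
        unfolding strategy_profile_def by (metis mem_Sigma_iff)
    qed
  qed
  then have "{S. strategy_profile n S} \<subseteq> ?f ` Pow (players n \<times> players n)"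
    by blast
  then show ?thesis
    by (rule finite_subset) (simp add: players_def)
qed

lemma strategy_profile_zero: "strategy_profile n (\<lambda>v w. 0)"
  by (simp add: strategy_profile_def)

end

theory Submission
  imports Defs
begin

text \<open>For a connected graph with \<open>m\<close> edges let \<open>d(v, w)\<close> be the number of bridges separating \<open>v\<close>
  from \<open>w\<close>, so that \<open>m I\<^sub>v = \<Sum>\<^sub>w d(v, w)\<close>. There is a vertex \<open>c\<close> such that no bridge cuts off more
  than \<open>n/2\<close> vertices from \<open>c\<close>; hence each of the \<open>d(v, c)\<close> bridges between \<open>v\<close> and \<open>c\<close> contributes
  at least \<open>n/2\<close> to \<open>m I\<^sub>v\<close>. A link from \<open>v\<close> to \<open>c\<close> removes all of these contributions, so in
  equilibrium \<open>d(v, c) n/2 \<le> \<alpha> m\<close>, and the triangle inequality for \<open>d\<close> gives \<open>I\<^sub>v \<le> 4\<alpha>\<close>.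
  If \<open>m > 2n\<close>, some edge can be deleted without creating a bridge; its owner keeps it only if
  \<open>\<alpha> \<le> I\<^sub>v/(m - 1)\<close>, which forces \<open>m \<le> 5\<close>. Thus \<open>m \<le> 2n\<close>, the social cost is at most \<open>6\<alpha>n\<close>, and
  \<open>OPT \<ge> \<alpha>(n - 1)\<close> because connected graphs have at least \<open>n - 1\<close> edges.\<close>

section \<open>Reachability and relevance\<close>

text \<open>Defined from the edge set alone, without a vertex set or explicit walks: deleting an
  edge becomes a set difference, and proofs go by induction on the closure.\<close>

definition reach :: "'a set set \<Rightarrow> 'a \<Rightarrow> 'a \<Rightarrow> bool" where
  "reach F = (\<lambda>x y. {x, y} \<in> F)\<^sup>*\<^sup>*"

lemma reach_refl [simp]: "reach F x x"
  by (simp add: reach_def)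

lemma reach_edge: "{x, y} \<in> F \<Longrightarrow> reach F x y"
  by (auto simp: reach_def)

lemma reach_trans: "reach F x y \<Longrightarrow> reach F y z \<Longrightarrow> reach F x z"
  unfolding reach_def by (rule rtranclp_trans)

lemma reach_sym: "reach F x y \<Longrightarrow> reach F y x"
  unfolding reach_def
proof (induction rule: rtranclp_induct)
  case (step y z)
  then show ?case
    by (metis (no_types, lifting) converse_rtranclp_into_rtranclp insert_commute)
qed simp

lemma reach_mono: "reach F x y \<Longrightarrow> F \<subseteq> G \<Longrightarrow> reach G x y"
  unfolding reach_def by (erule rtranclp_mono[THEN predicate2D, rotated]) auto

text \<open>A walk can be shortened until it crosses the new edge at most once; the three cases are
  no crossing and one crossing in either direction.\<close>

lemma reach_insertD:
  assumes "reach (insert {a, b} F) x y"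
  shows "reach F x y \<or> (reach F x a \<and> reach F b y) \<or> (reach F x b \<and> reach F a y)"
  using assms unfolding reach_def[of "insert {a, b} F"]
proof (induction rule: rtranclp_induct)
  case base
  then show ?case by simp
next
  case (step y z)
  then consider "{y, z} \<in> F" | "y = a" "z = b" | "y = b" "z = a"
    by (auto simp: doubleton_eq_iff)
  then show ?case
    using step.IH by cases (blast intro: reach_refl reach_edge reach_trans)+
qed

lemma reach_meet: "reach F x z \<Longrightarrow> reach F y z \<Longrightarrow> reach F x y"
  by (rule reach_trans[OF _ reach_sym])

lemma reach_insert_iff:
  "reach (insert {a, b} F) x y
     \<longleftrightarrow> reach F x y \<or> (reach F x a \<and> reach F b y) \<or> (reach F x b \<and> reach F a y)"
proof -
  let ?G = "insert {a, b} F"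
  have mono: "reach F u w \<Longrightarrow> reach ?G u w" for u w
    by (erule reach_mono) auto
  have ab: "reach ?G a b" "reach ?G b a"
    by (auto intro: reach_edge simp: insert_commute)
  have "reach ?G x y" if "reach F x a" "reach F b y"
    using reach_trans[OF mono[OF that(1)] reach_trans[OF ab(1) mono[OF that(2)]]] .
  moreover have "reach ?G x y" if "reach F x b" "reach F a y"
    using reach_trans[OF mono[OF that(1)] reach_trans[OF ab(2) mono[OF that(2)]]] .
  ultimately show ?thesis using mono reach_insertD by metis
qed

section \<open>Walks and reachability\<close>

lemma walk_reach:
  assumes "walk_betw V F v p w"
  shows "reach F v w"
proof -
  have "reach F (hd p) (last p)" if "p \<noteq> []" "successively (\<lambda>x y. {x, y} \<in> F) p"
    using that
  proof (induction p rule: induct_list012)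
    case (3 x y zs)
    then show ?case by (auto intro: reach_trans reach_edge)
  qed auto
  with assms show ?thesis by (auto simp: walk_betw_def)
qed

lemma reach_walk:
  assumes "reach F v w" "v \<in> V" "\<And>e. e \<in> F \<Longrightarrow> e \<subseteq> V"
  shows "\<exists>p. walk_betw V F v p w"
  using assms(1) unfolding reach_def
proof (induction rule: rtranclp_induct)
  case base
  have "walk_betw V F v [v] v" using assms(2) by (simp add: walk_betw_def)
  then show ?case ..
next
  case (step y z)
  then obtain p where "walk_betw V F v p y" by blast
  then have "walk_betw V F v (p @ [z]) z"
    using step.hyps(2) assms(3)[OF step.hyps(2)]
    by (auto simp: walk_betw_def successively_append_iff)
  then show ?case ..
qed

text \<open>Turns the quantification over walks in \<open>relevance\<close> into reachability after
  the deletion of \<open>e\<close>.\<close>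

lemma walk_avoiding_iff:
  "walk_betw V E v p w \<and> e \<notin> walk_edges p \<longleftrightarrow> walk_betw V (E - {e}) v p w"
  unfolding walk_betw_def walk_edges_def successively_conv_nth by auto

section \<open>Finite simple graphs and spanning forests\<close>

locale fin_graph =
  fixes V :: "'a set" and E :: "'a set set"
  assumes finite_V: "finite V"
    and edge_ends: "e \<in> E \<Longrightarrow> \<exists>a\<in>V. \<exists>b\<in>V. a \<noteq> b \<and> e = {a, b}"
begin

lemma edge_subset: "e \<in> E \<Longrightarrow> e \<subseteq> V"
  using edge_ends by blast

lemma finite_E: "finite E"
  by (rule finite_subset[of _ "Pow V"]) (use edge_subset finite_V in auto)

lemma subgraph: "F \<subseteq> E \<Longrightarrow> fin_graph V F"
  by unfold_locales (use finite_V edge_ends in blast)+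

lemma relevance_eq:
  assumes "v \<in> V"
  shows "relevance V E e v = card {w \<in> V. \<not> reach (E - {e}) v w}"
proof -
  have "(\<forall>p. walk_betw V E v p w \<longrightarrow> e \<in> walk_edges p) \<longleftrightarrow> \<not> reach (E - {e}) v w" for w
    using walk_avoiding_iff[of V E v _ w e] walk_reach[of V "E - {e}" v _ w]
      reach_walk[of "E - {e}" v w V] assms edge_subset by blast
  then show ?thesis by (simp add: relevance_def)
qed

lemma relevance_eq_0:
  assumes "v \<in> V" "\<And>u. u \<in> V \<Longrightarrow> reach (E - {e}) v u"
  shows "relevance V E e v = 0"
proof -
  have "{u \<in> V. \<not> reach (E - {e}) v u} = {}" using assms(2) by blast
  then show ?thesis using relevance_eq[OF assms(1)] by (metis card.empty)
qed

lemma connected_iff: "connected_graph V E \<longleftrightarrow> (\<forall>v\<in>V. \<forall>w\<in>V. reach E v w)"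
  unfolding connected_graph_def using walk_reach reach_walk edge_subset by metis

text \<open>The map \<open>f\<close> assigns to every vertex a representative of its connected component.\<close>

lemma spanning_forest:
  "\<exists>T (f :: 'a \<Rightarrow> 'a). T \<subseteq> E \<and> (\<forall>x y. reach T x y \<longleftrightarrow> f x = f y) \<and> (\<forall>x y. reach E x y \<longrightarrow> reach T x y)
     \<and> card T + card (f ` V) = card V"
  using finite_E fin_graph_axioms
proof (induction rule: finite_induct)
  case empty
  have "reach {} x y \<longleftrightarrow> x = y" for x y :: 'a
    by (auto simp: reach_def elim: rtranclp.cases)
  then show ?case by (intro exI[of _ "{}"] exI[of _ id]) simp
next
  case (insert e F)
  interpret g: fin_graph V "insert e F" by fact
  obtain T and f :: "'a \<Rightarrow> 'a" where T: "T \<subseteq> F" "\<forall>x y. reach T x y \<longleftrightarrow> f x = f y"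
      "\<forall>x y. reach F x y \<longrightarrow> reach T x y" "card T + card (f ` V) = card V"
    using insert.IH[OF g.subgraph[OF subset_insertI]] by (elim exE conjE, intro that)
  note T = T[rule_format]
  obtain a b where ab: "a \<in> V" "b \<in> V" "e = {a, b}" using g.edge_ends[of e] by blast
  have ins: "reach (insert e F) x y \<Longrightarrow> reach (insert e T) x y" for x y
    unfolding ab(3) reach_insert_iff using T(3) by blast
  show ?case
  proof (cases "f a = f b")
    case True
    then have "reach T x y" if "reach (insert e T) x y" for x y
      using that unfolding ab(3) reach_insert_iff T(2) by auto
    then show ?thesis using T ins by (intro exI[of _ T] exI[of _ f]) blast
  next
    case False
    \<comment> \<open>\<open>h\<close> renames the component of \<open>b\<close> to that of
      \<open>a\<close>: the image loses exactly \<open>f b\<close> while the forest gains one edge,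
      so the count is preserved.\<close>
    define h where "h = (\<lambda>x. if f x = f b then f a else f x)"
    have "e \<notin> T" using False T(2)[of a b] reach_edge[of a b T] ab by auto
    have "h ` V = f ` V - {f b}" using False ab by (auto simp: h_def)
    moreover have "card (f ` V - {f b}) = card (f ` V) - 1" "card (f ` V) > 0"
      using ab finite_V by (auto simp: card_gt_0_iff)
    moreover have "card (insert e T) = Suc (card T)"
      using \<open>e \<notin> T\<close> T(1) insert.hyps finite_subset by (metis card_insert_disjoint)
    ultimately have "card (insert e T) + card (h ` V) = card V" using T(4) by simp
    moreover have "reach (insert e T) x y \<longleftrightarrow> h x = h y" for x y
      by (auto simp: ab(3) reach_insert_iff T(2) h_def)
    ultimately show ?thesis
      using T(1) ins by (intro exI[of _ "insert e T"] exI[of _ h]) blast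
  qed
qed

text \<open>An edge outside two successive spanning forests has its ends joined by two further
  edge-disjoint paths, so deleting it creates no new bridge.\<close>

lemma redundant_edge:
  assumes "card E > 2 * card V"
  obtains e where "e \<in> E" "\<And>x y. reach E x y \<Longrightarrow> reach (E - {e}) x y"
    "\<And>e' x y. reach (E - {e'}) x y \<Longrightarrow> reach (E - {e} - {e'}) x y"
proof -
  obtain T f where T: "T \<subseteq> E" "\<And>x y. reach E x y \<Longrightarrow> reach T x y" "card T \<le> card V"
    using spanning_forest by (metis le_add1)
  interpret g: fin_graph V "E - T" using subgraph by blast
  obtain U g where U: "U \<subseteq> E - T" "\<And>x y. reach (E - T) x y \<Longrightarrow> reach U x y" "card U \<le> card V"
    using g.spanning_forest by (metis le_add1)
  have "card (T \<union> U) \<le> 2 * card V" using card_Un_le[of T U] T U by linarith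
  then have "\<not> E \<subseteq> T \<union> U"
    using assms card_mono[of "T \<union> U" E] T(1) U(1) finite_E by (meson finite_Diff finite_UnI
        finite_subset le_trans not_less)
  then obtain e where e: "e \<in> E" "e \<notin> T" "e \<notin> U" by blast
  obtain a b where ab: "e = {a, b}" using edge_ends[OF e(1)] by blast
  have "reach T a b" "reach U a b" using T(2) U(2) e reach_edge ab by (metis, metis DiffI)
  \<comment> \<open>\<open>T\<close> and \<open>U\<close> are disjoint and both miss
    \<open>e\<close>, so whichever \<open>e'\<close> is deleted, one of them still joins
    \<open>a\<close> to \<open>b\<close>.\<close>
  then have ab': "reach (E - {e} - {e'}) a b" for e'
    using reach_mono[of T a b "E - {e} - {e'}"] reach_mono[of U a b "E - {e} - {e'}"] T(1) U(1) e
    by blast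
  \<comment> \<open>A walk in \<open>G\<close> that crosses \<open>e\<close> is rerouted between
    \<open>a\<close> and \<open>b\<close>; applied below to \<open>E\<close> and to
    \<open>E - {e'}\<close>.\<close>
  have *: "reach (G - {e}) x y" if "reach G x y" "reach (G - {e}) a b" for G x y
  proof -
    have "reach (insert {a, b} (G - {e})) x y"
      using that(1) by (rule reach_mono) (auto simp: ab)
    then show ?thesis
      using reach_insertD[of a b "G - {e}" x y] that(2) reach_sym[OF that(2)]
        reach_trans[of "G - {e}"] by blast
  qed
  have "reach (E - {e}) a b" using reach_mono[OF ab'] by blast
  moreover have "E - {e'} - {e} = E - {e} - {e'}" for e' by auto
  ultimately show ?thesis using that[OF e(1)] *[of E] *[of "E - {e'}" for e'] ab' by metis
qed

end

section \<open>Relevance and bridges in connected graphs\<close>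

locale conn_graph = fin_graph +
  assumes conn: "x \<in> V \<Longrightarrow> y \<in> V \<Longrightarrow> reach E x y"
begin

text \<open>All vertices share one component, so a spanning forest already has at least
  \<open>card V - 1\<close> edges.\<close>

lemma card_edges_ge:
  assumes "V \<noteq> {}"
  shows "card V \<le> card E + 1"
proof -
  obtain T and f :: "'a \<Rightarrow> 'a" where T: "T \<subseteq> E" "\<forall>x y. reach T x y \<longleftrightarrow> f x = f y"
    "\<forall>x y. reach E x y \<longrightarrow> reach T x y" "card T + card (f ` V) = card V"
    using spanning_forest by (elim exE conjE, intro that)
  obtain r where "r \<in> V" using assms by blast
  then have "f ` V \<subseteq> {f r}" using T(2,3) conn by blast
  then have "card (f ` V) \<le> 1" using card_mono[of "{f r}" "f ` V"] by simp
  moreover have "card T \<le> card E" using T(1) finite_E card_mono by blast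
  ultimately show ?thesis using T(4) by linarith
qed

text \<open>After the deletion of \<open>e\<close> every vertex still reaches an end of
  \<open>e\<close>, so there are at most two components, and the separated \<open>x\<close> and
  \<open>y\<close> represent them.\<close>

lemma two_sides:
  assumes "\<not> reach (E - {e}) x y" "x \<in> V" "y \<in> V" "u \<in> V"
  shows "reach (E - {e}) x u \<longleftrightarrow> \<not> reach (E - {e}) y u"
proof -
  \<comment> \<open>Otherwise \<open>E - {e} = E\<close> would join \<open>x\<close> to
    \<open>y\<close>.\<close>
  have "e \<in> E" using assms conn[of x y] by (metis Diff_empty Diff_insert0)
  then obtain a b where ab: "a \<in> V" "e = {a, b}" using edge_ends by blast
  have "reach (insert {a, b} (E - {e})) w a" if "w \<in> V" for w
    using conn[OF that ab(1)] by (rule reach_mono) (auto simp: ab)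
  then have sides: "reach (E - {e}) w a \<or> reach (E - {e}) w b" if "w \<in> V" for w
    using reach_insertD[of a b "E - {e}" w a] that by blast
  have "reach (E - {e}) x u \<or> reach (E - {e}) y u"
    using sides[OF assms(2)] sides[OF assms(3)] sides[OF assms(4)] assms(1)
    by (blast intro: reach_meet)
  moreover have "\<not> (reach (E - {e}) x u \<and> reach (E - {e}) y u)"
    using assms(1) reach_trans[of "E - {e}"] reach_sym[of "E - {e}"] by blast
  ultimately show ?thesis by blast
qed

text \<open>The two sides of a bridge partition \<open>V\<close>, and from either side the relevance
  is the size of the other.\<close>

lemma relevance_complement:
  assumes "\<not> reach (E - {e}) x y" "x \<in> V" "y \<in> V"
  shows "relevance V E e x + relevance V E e y = card V"
proof -
  let ?X = "{w \<in> V. \<not> reach (E - {e}) x w}" and ?Y = "{w \<in> V. \<not> reach (E - {e}) y w}"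
  have "?X \<inter> ?Y = {}" "?X \<union> ?Y = V" using two_sides[OF assms] by blast+
  then show ?thesis
    using card_Un_disjoint[of ?X ?Y] finite_V assms by (simp add: relevance_eq)
qed

lemma relevance_cong:
  assumes "reach (E - {e}) x y" "x \<in> V" "y \<in> V"
  shows "relevance V E e x = relevance V E e y"
proof -
  have "reach (E - {e}) x w \<longleftrightarrow> reach (E - {e}) y w" for w
    using assms(1) reach_trans[of "E - {e}"] reach_sym[of "E - {e}"] by blast
  then show ?thesis using assms(2,3) by (simp add: relevance_eq)
qed

definition total_rel :: "'a \<Rightarrow> nat" where
  "total_rel v = (\<Sum>e\<in>E. relevance V E e v)"

text \<open>A minimiser of \<open>total_rel\<close> works: crossing an edge towards a side with more than half of the
  vertices increases no relevance and decreases that of the crossed edge.\<close>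

lemma centroid:
  assumes "V \<noteq> {}"
  obtains c where "c \<in> V" "\<And>e. e \<in> E \<Longrightarrow> 2 * relevance V E e c \<le> card V"
proof -
  define c where "c = arg_min_on total_rel V"
  have c: "c \<in> V" "\<And>v. v \<in> V \<Longrightarrow> total_rel c \<le> total_rel v"
    unfolding c_def using arg_min_if_finite[OF finite_V assms, of total_rel] by (auto simp: not_less)
  have "2 * relevance V E e c \<le> card V" if e: "e \<in> E" for e
  proof (rule ccontr)
    assume neg: "\<not> ?thesis"
    \<comment> \<open>\<open>b\<close> is the end of \<open>e\<close> on the far side from
      \<open>c\<close>. It need not be adjacent to \<open>c\<close>, so all bridges between the two
      have to be compared.\<close>
    obtain a b where ab: "a \<in> V" "b \<in> V" "e = {a, b}" and cb: "\<not> reach (E - {e}) c b"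
    proof -
      obtain a b where ab: "a \<in> V" "b \<in> V" "e = {a, b}" using edge_ends[OF e] by blast
      have "\<exists>u\<in>V. \<not> reach (E - {e}) c u"
      proof (rule ccontr)
        assume "\<not> ?thesis"
        then have "relevance V E e c = 0" using c(1) by (intro relevance_eq_0) auto
        then show False using neg by simp
      qed
      then obtain u where u: "u \<in> V" "\<not> reach (E - {e}) c u" by blast
      have "reach (insert {a, b} (E - {e})) c u"
        using conn[OF c(1) u(1)] by (rule reach_mono) (auto simp: ab)
      then have "\<not> reach (E - {e}) c a \<or> \<not> reach (E - {e}) c b"
        using reach_insertD u(2) reach_trans by metis
      then show ?thesis using that[of a b] that[of b a] ab by (auto simp: insert_commute)
    qed
    have less: "relevance V E e' b < relevance V E e' c"
      if e': "\<not> reach (E - {e'}) c b" for e'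
    proof -
      \<comment> \<open>If \<open>e'\<close> also separates \<open>c\<close> from \<open>b\<close>,
        then \<open>c\<close> gets to neither end of \<open>e\<close> without \<open>e'\<close>, so
        whatever \<open>c\<close> reaches without \<open>e'\<close> it reaches without
        \<open>e\<close> too. Hence \<open>e'\<close> cuts off more than half of the vertices from
        \<open>c\<close>, and fewer than half from \<open>b\<close>.\<close>
      have "{u \<in> V. \<not> reach (E - {e}) c u} \<subseteq> {u \<in> V. \<not> reach (E - {e'}) c u}"
      proof (cases "e' = e")
        case False
        let ?F = "E - {e'} - {e}"
        have "\<not> reach (E - {e'}) c a"
          using e' reach_trans[OF _ reach_edge[of a b "E - {e'}"], of c] e ab False by auto
        then have "\<not> reach ?F c a" "\<not> reach ?F c b"
          using e' reach_mono[of ?F c _ "E - {e'}"] by blast+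
        moreover have "insert {a, b} ?F = E - {e'}" using ab e False by auto
        ultimately have "reach ?F c u" if "reach (E - {e'}) c u" for u
          using reach_insertD[of a b ?F c u] that by simp
        then show ?thesis using reach_mono[of ?F c _ "E - {e}"] by blast
      qed auto
      then have "relevance V E e c \<le> relevance V E e' c"
        using c(1) finite_V by (simp add: relevance_eq card_mono)
      then show ?thesis using relevance_complement[OF e' c(1) ab(2)] neg by linarith
    qed
    \<comment> \<open>Edges that do not separate \<open>c\<close> from \<open>b\<close> have the
      same relevance for both.\<close>
    have "relevance V E e' b \<le> relevance V E e' c" for e'
      using less[of e'] relevance_cong[of e' c b] c(1) ab(2) by (metis less_or_eq_imp_le)
    then have "total_rel b < total_rel c"
      unfolding total_rel_def using less[OF cb] e finite_E by (intro sum_strict_mono_ex1) auto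
    then show False using c(2)[OF ab(2)] by simp
  qed
  with c(1) that show ?thesis by blast
qed

text \<open>The cardinality of this set is the distance d(v, w) of the overview.\<close>

definition bridges :: "'a \<Rightarrow> 'a \<Rightarrow> 'a set set" where
  "bridges v w = {e \<in> E. \<not> reach (E - {e}) v w}"

text \<open>Double counting of the pairs of an edge \<open>e\<close> and a vertex \<open>w\<close>
  that \<open>e\<close> separates from \<open>v\<close>.\<close>

lemma total_rel_eq:
  assumes "v \<in> V"
  shows "total_rel v = (\<Sum>w\<in>V. card (bridges v w))"
proof -
  have "total_rel v = (\<Sum>e\<in>E. \<Sum>w\<in>V. if \<not> reach (E - {e}) v w then 1 else 0)"
    using assms finite_V by (simp add: total_rel_def relevance_eq flip: sum.inter_filter)
  also have "\<dots> = (\<Sum>w\<in>V. \<Sum>e\<in>E. if \<not> reach (E - {e}) v w then 1 else 0)"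
    by (rule sum.swap)
  also have "\<dots> = (\<Sum>w\<in>V. card (bridges v w))"
    using finite_E by (simp add: bridges_def flip: sum.inter_filter)
  finally show ?thesis .
qed

text \<open>An edge that separates neither \<open>v\<close> nor \<open>w\<close> from
  \<open>c\<close> cannot separate \<open>v\<close> from \<open>w\<close>.\<close>

lemma card_bridges_triangle: "card (bridges v w) \<le> card (bridges v c) + card (bridges w c)"
proof -
  have "reach (E - {e}) v w" if "reach (E - {e}) v c" "reach (E - {e}) w c" for e
    using reach_trans[OF that(1) reach_sym[OF that(2)]] .
  then have "bridges v w \<subseteq> bridges v c \<union> bridges w c"
    unfolding bridges_def by blast
  moreover have "finite (bridges v c \<union> bridges w c)"
    using finite_E by (simp add: bridges_def)
  ultimately have "card (bridges v w) \<le> card (bridges v c \<union> bridges w c)" by (rule card_mono[rotated])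
  then show ?thesis using card_Un_le le_trans by blast
qed

lemma total_rel_le:
  assumes "v \<in> V" and "\<And>w. w \<in> V \<Longrightarrow> real (card (bridges w c)) \<le> D"
  shows "real (total_rel v) \<le> 2 * D * card V"
proof -
  have "real (total_rel v) = (\<Sum>w\<in>V. real (card (bridges v w)))"
    using total_rel_eq[OF assms(1)] by simp
  also have "\<dots> \<le> (\<Sum>w\<in>V. 2 * D)"
  proof (rule sum_mono)
    fix w assume "w \<in> V"
    then show "real (card (bridges v w)) \<le> 2 * D"
      using card_bridges_triangle[of v w c] assms(2)[of v] assms(2)[of w] assms(1) by linarith
  qed
  finally show ?thesis by (simp add: mult_ac)
qed

text \<open>The new edge closes a cycle through all bridges between \<open>v\<close> and
  \<open>w\<close>, so these lose their relevance; the new edge has none, and no other relevance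
  grows. The saving stands on the left to avoid truncated subtraction.\<close>

lemma total_rel_add_edge:
  assumes "v \<in> V" "w \<in> V" "v \<noteq> w" "{v, w} \<notin> E"
  shows "(\<Sum>e\<in>insert {v, w} E. relevance V (insert {v, w} E) e v)
           + (\<Sum>e\<in>bridges v w. relevance V E e v) \<le> total_rel v"
proof -
  let ?f = "{v, w}"
  interpret g: fin_graph V "insert ?f E"
    by unfold_locales (use finite_V edge_ends assms in auto)
  have rel: "relevance V (insert ?f E) e v = card {u \<in> V. \<not> reach (insert ?f E - {e}) v u}" for e
    using g.relevance_eq assms(1) by blast
  have "insert ?f E - {?f} = E" using assms by auto
  then have f: "relevance V (insert ?f E) ?f v = 0"
    using conn[OF assms(1)] assms(1) by (intro g.relevance_eq_0) auto
  have 1: "relevance V (insert ?f E) e v \<le> relevance V E e v" for e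
    unfolding rel relevance_eq[OF assms(1)]
    using finite_V reach_mono[of "E - {e}" v _ "insert ?f E - {e}"] by (intro card_mono) auto
  have 2: "relevance V (insert ?f E) e v = 0" if "e \<in> bridges v w" for e
  proof -
    from that have e: "e \<in> E" "\<not> reach (E - {e}) v w" by (auto simp: bridges_def)
    have "reach (insert ?f E - {e}) v w" using e assms by (intro reach_edge) auto
    moreover have "reach (E - {e}) v u \<or> reach (E - {e}) w u" if "u \<in> V" for u
      using two_sides[OF e(2) assms(1,2) that] by blast
    ultimately have "reach (insert ?f E - {e}) v u" if "u \<in> V" for u
      using that reach_trans[of "insert ?f E - {e}" v w u]
        reach_mono[of "E - {e}" _ u "insert ?f E - {e}"] by blast
    then show ?thesis using assms(1) by (intro g.relevance_eq_0) auto
  qed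
  have fin: "finite (bridges v w)" "bridges v w \<subseteq> E" using finite_E by (auto simp: bridges_def)
  have "(\<Sum>e\<in>insert ?f E. relevance V (insert ?f E) e v)
      = (\<Sum>e\<in>E. relevance V (insert ?f E) e v)"
    using f finite_E assms(4) by simp
  also have "\<dots> = (\<Sum>e\<in>E - bridges v w. relevance V (insert ?f E) e v)"
    using 2 finite_E by (intro sum.mono_neutral_right) auto
  also have "\<dots> \<le> (\<Sum>e\<in>E - bridges v w. relevance V E e v)"
    using 1 by (rule sum_mono)
  finally show ?thesis
    unfolding total_rel_def using sum.subset_diff[OF fin(2) finite_E, of "\<lambda>e. relevance V E e v"]
    by simp
qed

text \<open>The assumptions are those that \<open>redundant_edge\<close> provides. Separation by
  \<open>e'\<close> in the smaller graph implies separation by \<open>e'\<close> in the larger one,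
  so no relevance grows.\<close>

lemma total_rel_remove_edge:
  assumes "v \<in> V" "e \<in> E" "\<And>x y. reach E x y \<Longrightarrow> reach (E - {e}) x y"
    "\<And>e' x y. reach (E - {e'}) x y \<Longrightarrow> reach (E - {e} - {e'}) x y"
  shows "(\<Sum>e'\<in>E - {e}. relevance V (E - {e}) e' v) \<le> total_rel v"
proof -
  interpret g: fin_graph V "E - {e}" by (rule subgraph) auto
  have "relevance V (E - {e}) e' v \<le> relevance V E e' v" for e'
    unfolding g.relevance_eq[OF assms(1)] relevance_eq[OF assms(1)]
    using finite_V assms(4) by (intro card_mono) auto
  then have "(\<Sum>e'\<in>E - {e}. relevance V (E - {e}) e' v) \<le> (\<Sum>e'\<in>E - {e}. relevance V E e' v)"
    by (rule sum_mono)
  also have "\<dots> \<le> total_rel v" unfolding total_rel_def using finite_E by (intro sum_mono2) auto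
  finally show ?thesis .
qed

end

section \<open>The game\<close>

lemma finite_players [simp]: "finite (players n)" and card_players [simp]: "card (players n) = n"
  by (simp_all add: players_def)

text \<open>Ordered pairs record who pays for a link; the map to unordered edges merges double
  requests, which the profiles competing in \<open>OPT\<close> may contain.\<close>

definition links :: "nat \<Rightarrow> (nat \<Rightarrow> nat \<Rightarrow> nat) \<Rightarrow> (nat \<times> nat) set" where
  "links n S = {(v, w) \<in> players n \<times> players n. S v w = 1}"

lemma finite_links: "finite (links n S)"
  by (rule finite_subset[of _ "players n \<times> players n"]) (auto simp: links_def)

lemma final_edges_eq_links: "final_edges n S = (\<lambda>(v, w). {v, w}) ` links n S"
  by (force simp: final_edges_def links_def image_iff insert_commute)

lemma sum_links:
  assumes "strategy_profile n S"
  shows "(\<Sum>v\<in>players n. \<Sum>w\<in>players n. real (S v w)) = card (links n S)"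
proof -
  have "(\<Sum>v\<in>players n. \<Sum>w\<in>players n. real (S v w))
      = (\<Sum>p\<in>players n \<times> players n. if case p of (v, w) \<Rightarrow> S v w = 1 then 1 else 0)"
    unfolding sum.cartesian_product
    using assms by (intro sum.cong) (auto simp: strategy_profile_def, metis)
  also have "\<dots> = (\<Sum>p\<in>{p \<in> players n \<times> players n. case p of (v, w) \<Rightarrow> S v w = 1}. 1)"
    by (rule sum.inter_filter[symmetric]) simp
  also have "{p \<in> players n \<times> players n. case p of (v, w) \<Rightarrow> S v w = 1} = links n S"
    by (auto simp: links_def)
  finally show ?thesis by simp
qed

lemma fin_graph_final_edges:
  assumes "strategy_profile n S"
  shows "fin_graph (players n) (final_edges n S)"
proof
  fix e assume "e \<in> final_edges n S"
  then obtain v w where e: "v \<in> players n" "w \<in> players n" "S v w = 1 \<or> S w v = 1" "e = {v, w}"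
    unfolding final_edges_def by blast
  have "v \<noteq> w" using e(3) assms by (auto simp: strategy_profile_def)
  with e show "\<exists>a\<in>players n. \<exists>b\<in>players n. a \<noteq> b \<and> e = {a, b}" by blast
qed simp

lemma individual_cost_connected:
  assumes "connected_graph (players n) (final_edges n S)"
  shows "individual_cost n \<alpha> S v = ereal (\<alpha> * (\<Sum>w\<in>players n. real (S v w))
    + real (\<Sum>e\<in>final_edges n S. relevance (players n) (final_edges n S) e v)
        / card (final_edges n S))"
  using assms by (simp add: individual_cost_def disconnection_cost_def)

text \<open>If the graph is connected, the link payments alone give the bound; otherwise the cost is
  infinite.\<close>

lemma social_cost_ge:
  assumes "strategy_profile n S" "n \<ge> 1" "\<alpha> > 0"
  shows "ereal (\<alpha> * (real n - 1)) \<le> social_cost n \<alpha> S"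
proof (cases "connected_graph (players n) (final_edges n S)")
  case True
  interpret fin_graph "players n" "final_edges n S"
    by (rule fin_graph_final_edges) fact
  interpret conn_graph "players n" "final_edges n S"
    by unfold_locales (use True connected_iff in blast)
  have "n \<le> card (final_edges n S) + 1"
    using card_edges_ge assms(2) by (fastforce simp: players_def)
  also have "\<dots> \<le> card (links n S) + 1"
    by (simp add: final_edges_eq_links card_image_le finite_links)
  finally have "\<alpha> * (real n - 1) \<le> \<alpha> * card (links n S)"
    using assms(3) by simp
  also have "\<dots> = (\<Sum>v\<in>players n. \<alpha> * (\<Sum>w\<in>players n. real (S v w)))"
    by (simp add: sum_links[OF assms(1), symmetric] sum_distrib_left)
  finally have "ereal (\<alpha> * (real n - 1)) \<le> (\<Sum>v\<in>players n. ereal (\<alpha> * (\<Sum>w\<in>players n. real (S v w))))"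
    by simp
  also have "\<dots> \<le> social_cost n \<alpha> S"
    unfolding social_cost_def
    by (rule sum_mono) (simp add: individual_cost_connected[OF True] sum_nonneg)
  finally show ?thesis .
next
  case False
  have "1 \<in> players n" using assms(2) by (simp add: players_def)
  moreover have "individual_cost n \<alpha> S 1 = \<infinity>"
    using False by (simp add: individual_cost_def disconnection_cost_def)
  ultimately have "social_cost n \<alpha> S = \<infinity>"
    unfolding social_cost_def sum_Pinfty by auto
  then show ?thesis by simp
qed

lemma OPT_ge:
  assumes "n \<ge> 1" "\<alpha> > 0"
  shows "ereal (\<alpha> * (real n - 1)) \<le> OPT n \<alpha>"
  unfolding OPT_def using finite_strategy_profiles strategy_profile_zero social_cost_ge assms
  by (subst Min_ge_iff) auto

lemma nash_deviation:
  assumes "nash_equilibrium n \<alpha> S" "v \<in> players n" "strategy_profile n (S(v := r))"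
  shows "individual_cost n \<alpha> S v \<le> individual_cost n \<alpha> (S(v := r)) v"
  using assms unfolding nash_equilibrium_def by (simp add: not_less)

lemma nash_connected:
  assumes "nash_equilibrium n \<alpha> S"
  shows "connected_graph (players n) (final_edges n S)"
proof (rule ccontr)
  assume nc: "\<not> ?thesis"
  then obtain v where v: "v \<in> players n" by (auto simp: connected_graph_def)
  \<comment> \<open>Linking to every other player connects the graph at finite cost.\<close>
  define r :: "nat \<Rightarrow> nat" where "r = (\<lambda>w. if w \<in> players n \<and> w \<noteq> v then 1 else 0)"
  have sp: "strategy_profile n (S(v := r))"
    using assms v unfolding nash_equilibrium_def strategy_profile_def r_def by auto
  interpret fin_graph "players n" "final_edges n (S(v := r))"
    by (rule fin_graph_final_edges) fact
  have "{v, w} \<in> final_edges n (S(v := r))" if "w \<in> players n" "w \<noteq> v" for w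
    unfolding final_edges_def using that v by (auto simp: r_def)
  then have "reach (final_edges n (S(v := r))) w v" if "w \<in> players n" for w
    using that by (cases "w = v") (auto intro: reach_edge simp: insert_commute)
  then have "connected_graph (players n) (final_edges n (S(v := r)))"
    unfolding connected_iff by (blast intro: reach_meet)
  then have "individual_cost n \<alpha> (S(v := r)) v < \<infinity>"
    by (simp add: individual_cost_connected)
  moreover have "individual_cost n \<alpha> S v = \<infinity>"
    using nc by (simp add: individual_cost_def disconnection_cost_def)
  ultimately show False using nash_deviation[OF assms v sp] by simp
qed

section \<open>Bounds for a Nash equilibrium\<close>

locale equilibrium =
  fixes n :: nat and \<alpha> :: real and S :: "nat \<Rightarrow> nat \<Rightarrow> nat"
  assumes n: "n \<ge> 3" and \<alpha>: "\<alpha> > 0" and nash: "nash_equilibrium n \<alpha> S" and essential: "essential S"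
begin

abbreviation "V \<equiv> players n"
abbreviation "E \<equiv> final_edges n S"

lemma profile: "strategy_profile n S"
  using nash by (simp add: nash_equilibrium_def)

sublocale fin_graph V E
  by (rule fin_graph_final_edges) (rule profile)

sublocale conn_graph V E
  by unfold_locales (use nash_connected[OF nash] connected_iff in blast)

text \<open>Essential profiles never request an edge from both ends. Hence links and edges are
  equally many, and dropping a link really deletes its edge.\<close>

lemma inj_links: "inj_on (\<lambda>(v, w). {v, w}) (links n S)"
  using essential by (auto simp: inj_on_def links_def essential_def doubleton_eq_iff)

lemma V_nonempty: "V \<noteq> {}"
  using n by (auto simp: players_def)

lemma card_E_ge: "card E \<ge> 2"
  using card_edges_ge[OF V_nonempty] n by simp

lemma individual_cost_eq:
  "individual_cost n \<alpha> S v
     = ereal (\<alpha> * (\<Sum>w\<in>V. real (S v w)) + real (total_rel v) / card E)"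
  by (simp add: individual_cost_connected[OF nash_connected[OF nash]] total_rel_def)

lemma sum_update:
  assumes "w \<in> V"
  shows "(\<Sum>u\<in>V. real (((S v)(w := x)) u)) = (\<Sum>u\<in>V. real (S v u)) - real (S v w) + real x"
  using assms by (simp add: sum.remove[of V w])

text \<open>Buying the link to \<open>w\<close> costs \<alpha> and, by
  \<open>total_rel_add_edge\<close>, saves at least the relevance of these bridges divided by
  \<open>card E\<close>; the larger edge count after the deviation can only lower the cost
  further.\<close>

lemma sum_relevance_bridges_le:
  assumes v: "v \<in> V" and w: "w \<in> V" and vw: "v \<noteq> w" "{v, w} \<notin> E"
  shows "real (\<Sum>e\<in>bridges v w. relevance V E e v) \<le> \<alpha> * card E"
proof -
  define T where "T = S(v := (S v)(w := 1))"
  have Svw: "S v w = 0" "S w v = 0"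
    using vw(2) v w profile unfolding final_edges_def strategy_profile_def by blast+
  have sp: "strategy_profile n T"
    using profile v w vw(1) unfolding strategy_profile_def T_def by auto
  have edges: "final_edges n T = insert {v, w} E"
  proof -
    have "links n T = insert (v, w) (links n S)" using v w by (auto simp: links_def T_def split: if_splits)
    then show ?thesis by (simp add: final_edges_eq_links)
  qed
  interpret T: fin_graph V "final_edges n T"
    by (rule fin_graph_final_edges) fact
  have "connected_graph V (final_edges n T)"
    unfolding T.connected_iff unfolding edges using conn reach_mono[of E _ _ "insert {v, w} E"] by blast
  from individual_cost_connected[OF this, of \<alpha> v] nash_deviation[OF nash v sp[unfolded T_def], folded T_def]
  have *: "\<alpha> * (\<Sum>u\<in>V. real (S v u)) + real (total_rel v) / card E
    \<le> \<alpha> * (\<Sum>u\<in>V. real (T v u))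
      + real (\<Sum>e\<in>insert {v, w} E. relevance V (insert {v, w} E) e v) / card (insert {v, w} E)"
    by (simp add: individual_cost_eq edges)
  have "(\<Sum>u\<in>V. real (T v u)) = (\<Sum>u\<in>V. real (S v u)) + 1"
    using sum_update[OF w, of v 1] Svw by (simp add: T_def)
  moreover have "real (\<Sum>e\<in>insert {v, w} E. relevance V (insert {v, w} E) e v)
        / card (insert {v, w} E)
      \<le> (real (total_rel v) - real (\<Sum>e\<in>bridges v w. relevance V E e v)) / card E"
  proof (rule frac_le)
    show "real (\<Sum>e\<in>insert {v, w} E. relevance V (insert {v, w} E) e v)
        \<le> real (total_rel v) - real (\<Sum>e\<in>bridges v w. relevance V E e v)"
      using total_rel_add_edge[OF v w vw] by linarith
    show "real (card E) \<le> card (insert {v, w} E)" using finite_E vw(2) by simp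
  qed (use total_rel_add_edge[OF v w vw] card_E_ge in linarith)+
  ultimately have "real (total_rel v) / card E
      \<le> \<alpha> + (real (total_rel v) - real (\<Sum>e\<in>bridges v w. relevance V E e v)) / card E"
    using * by (simp add: distrib_left)
  then show ?thesis using card_E_ge by (simp add: field_simps)
qed

text \<open>Dropping the link saves \<alpha> and raises the disconnection cost from R/m to at most
  R/(m - 1), where R = \<open>total_rel v\<close> and m = \<open>card E\<close>. In equilibrium
  R/(m(m - 1)) is therefore at least \<alpha>.\<close>

lemma redundant_edge_cost:
  assumes v: "v \<in> V" and w: "w \<in> V" and vw: "S v w = 1"
    and e: "\<And>x y. reach E x y \<Longrightarrow> reach (E - {{v, w}}) x y"
      "\<And>e' x y. reach (E - {e'}) x y \<Longrightarrow> reach (E - {{v, w}} - {e'}) x y"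
  shows "\<alpha> * card E * (real (card E) - 1) \<le> total_rel v"
proof -
  define T where "T = S(v := (S v)(w := 0))"
  have "links n T = links n S - {(v, w)}" by (auto simp: links_def T_def split: if_splits)
  then have edges: "final_edges n T = E - {{v, w}}"
    using inj_on_image_set_diff[OF inj_links, of "links n S" "{(v, w)}"] v w vw
    by (simp add: final_edges_eq_links links_def)
  have inE: "{v, w} \<in> E" using v w vw unfolding final_edges_def by blast
  have sp: "strategy_profile n T"
    using profile unfolding strategy_profile_def T_def by auto
  interpret T: fin_graph V "final_edges n T"
    by (rule fin_graph_final_edges) fact
  have "connected_graph V (final_edges n T)"
    unfolding T.connected_iff unfolding edges using conn e(1) by blast
  from individual_cost_connected[OF this, of \<alpha> v] nash_deviation[OF nash v sp[unfolded T_def], folded T_def]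
  have *: "\<alpha> * (\<Sum>u\<in>V. real (S v u)) + real (total_rel v) / card E
    \<le> \<alpha> * (\<Sum>u\<in>V. real (T v u))
      + real (\<Sum>e\<in>E - {{v, w}}. relevance V (E - {{v, w}}) e v) / card (E - {{v, w}})"
    by (simp add: individual_cost_eq edges)
  have "(\<Sum>u\<in>V. real (T v u)) = (\<Sum>u\<in>V. real (S v u)) - 1"
    using sum_update[OF w, of v 0] vw by (simp add: T_def)
  moreover have "real (card (E - {{v, w}})) = real (card E) - 1"
    using inE finite_E card_E_ge by (simp add: of_nat_diff)
  moreover have "real (\<Sum>e\<in>E - {{v, w}}. relevance V (E - {{v, w}}) e v)
      / (real (card E) - 1) \<le> real (total_rel v) / (real (card E) - 1)"
    using total_rel_remove_edge[OF v inE e] card_E_ge by (intro divide_right_mono) linarith+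
  ultimately have "\<alpha> + real (total_rel v) / card E \<le> real (total_rel v) / (real (card E) - 1)"
    using * by (simp add: right_diff_distrib)
  then show ?thesis using card_E_ge by (simp add: field_simps)
qed

lemma total_rel_bound:
  assumes "v \<in> V"
  shows "real (total_rel v) \<le> 4 * \<alpha> * card E"
proof -
  obtain c where c: "c \<in> V" "\<And>e. e \<in> E \<Longrightarrow> 2 * relevance V E e c \<le> card V"
    using centroid[OF V_nonempty] by blast
  \<comment> \<open>With D = 2\<alpha>m/n and m = \<open>card E\<close>, \<open>total_rel_le\<close>
    then yields 2Dn = 4\<alpha>m.\<close>
  have "real (card (bridges u c)) \<le> 2 * \<alpha> * card E / n" if u: "u \<in> V" for u
  proof (cases "bridges u c = {}")
    case True
    then show ?thesis using \<alpha> by simp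
  next
    case False
    then have "u \<noteq> c" by (auto simp: bridges_def)
    have half: "n \<le> 2 * relevance V E e u" if "e \<in> bridges u c" for e
      using relevance_complement[of e u c] c(2)[of e] that u c(1) by (auto simp: bridges_def)
    \<comment> \<open>A link to \<open>c\<close> is not available if \<open>u\<close> and \<open>c\<close> are already joined by a bridge; then a link
      to any other vertex beyond that bridge serves as well.\<close>
    obtain w where w: "w \<in> V" "u \<noteq> w" "{u, w} \<notin> E" "bridges u c \<subseteq> bridges u w"
    proof (cases "{u, c} \<in> E")
      case True
      let ?f = "{u, c}"
      \<comment> \<open>The edge joins \<open>u\<close> to \<open>c\<close> unless it is itself
        deleted, so no other bridge separates them.\<close>
      have "e = ?f" if "e \<in> bridges u c" for e
        using that True reach_edge[of u c "E - {e}"] by (auto simp: bridges_def)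
      then have f: "bridges u c = {?f}" using False by blast
      \<comment> \<open>As \<open>n \<ge> 3\<close>, at least n/2 vertices beyond the bridge means
        at least two, so one of them differs from \<open>c\<close>.\<close>
      have "relevance V E ?f u \<ge> 2" using half[of ?f] f n by simp
      then have "\<not> card {x \<in> V. \<not> reach (E - {?f}) u x} \<le> card {c}"
        by (simp add: relevance_eq[OF u])
      then have "\<not> {x \<in> V. \<not> reach (E - {?f}) u x} \<subseteq> {c}"
        using card_mono[of "{c}"] by blast
      then obtain w where w: "w \<in> V" "w \<noteq> c" "\<not> reach (E - {?f}) u w" by blast
      then have "u \<noteq> w" by auto
      \<comment> \<open>An edge from \<open>u\<close> to \<open>w\<close> would differ from
        \<open>?f\<close> and survive its deletion.\<close>
      moreover have "{u, w} \<notin> E"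
        using w(2,3) reach_edge[of u w "E - {?f}"] by (auto simp: doubleton_eq_iff)
      moreover have "bridges u c \<subseteq> bridges u w"
        using f w(3) True by (auto simp: bridges_def)
      ultimately show ?thesis using that w(1) by blast
    qed (use that c(1) \<open>u \<noteq> c\<close> in blast)
    have "card (bridges u c) * n \<le> (\<Sum>e\<in>bridges u c. 2 * relevance V E e u)"
      using sum_bounded_below[of "bridges u c" n] half by simp
    also have "\<dots> \<le> (\<Sum>e\<in>bridges u w. 2 * relevance V E e u)"
      using w(4) finite_E by (intro sum_mono2) (auto simp: bridges_def)
    finally have "card (bridges u c) * n \<le> 2 * (\<Sum>e\<in>bridges u w. relevance V E e u)"
      by (simp add: sum_distrib_left)
    then have "real (card (bridges u c)) * n \<le> 2 * real (\<Sum>e\<in>bridges u w. relevance V E e u)"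
      by (metis of_nat_mono of_nat_mult of_nat_numeral)
    then show ?thesis
      using sum_relevance_bridges_le[OF u w(1,2,3)] n by (simp add: field_simps)
  qed
  from total_rel_le[OF assms this] show ?thesis using n by simp
qed

lemma card_E_le: "card E \<le> 2 * n"
proof (rule ccontr)
  assume "\<not> ?thesis"
  then have big: "card E > 2 * card V" by simp
  obtain e where e: "e \<in> E" "\<And>x y. reach E x y \<Longrightarrow> reach (E - {e}) x y"
    "\<And>e' x y. reach (E - {e'}) x y \<Longrightarrow> reach (E - {e} - {e'}) x y"
    by (rule redundant_edge[OF big], rule that)
  obtain v w where vw: "e = {v, w}" "v \<in> V" "w \<in> V" "S v w = 1"
    using e(1) unfolding final_edges_eq_links links_def by auto
  \<comment> \<open>Comparing with the bound 4\<alpha>m on \<open>total_rel v\<close> and cancelling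
    \<alpha>m leaves m - 1 \<le> 4, against m > 2n \<ge> 6.\<close>
  have "\<alpha> * card E * (real (card E) - 1) \<le> \<alpha> * card E * 4"
    using redundant_edge_cost[OF vw(2-4)] e(2,3) total_rel_bound[OF vw(2)] vw(1)
    by (simp add: mult_ac)
  moreover have "\<alpha> * card E > 0" using \<alpha> card_E_ge by simp
  ultimately have "real (card E) - 1 \<le> 4" by (rule mult_left_le_imp_le)
  then show False using big n by simp
qed

lemma card_links: "card (links n S) = card E"
  by (simp add: final_edges_eq_links card_image[OF inj_links])

text \<open>At most 2n links cost 2\<alpha>n, and each of the n disconnection costs is at most
  4\<alpha>.\<close>

lemma social_cost_le: "social_cost n \<alpha> S \<le> ereal (6 * \<alpha> * n)"
proof -
  have "(\<Sum>v\<in>V. \<alpha> * (\<Sum>w\<in>V. real (S v w)) + real (total_rel v) / card E)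
      \<le> (\<Sum>v\<in>V. \<alpha> * (\<Sum>w\<in>V. real (S v w)) + 4 * \<alpha>)"
    using total_rel_bound card_E_ge by (intro sum_mono) (simp add: field_simps)
  also have "\<dots> = \<alpha> * card E + 4 * \<alpha> * n"
    by (simp add: sum.distrib sum_links[OF profile] card_links flip: sum_distrib_left)
  also have "\<dots> \<le> \<alpha> * (2 * n) + 4 * \<alpha> * n"
    using card_E_le \<alpha> by (intro add_mono mult_left_mono) linarith+
  finally show ?thesis by (simp add: social_cost_def individual_cost_eq)
qed

lemma cost_ratio_le: "social_cost n \<alpha> S / OPT n \<alpha> \<le> ereal (10 + 10 / (real n - 1))"
proof -
  have pos: "0 < \<alpha> * (real n - 1)" using \<alpha> n by simp
  have opt: "ereal (\<alpha> * (real n - 1)) \<le> OPT n \<alpha>" using OPT_ge n \<alpha> by simp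
  have optpos: "0 < OPT n \<alpha>"
    by (rule less_le_trans[OF _ opt]) (use pos in simp)
  have "social_cost n \<alpha> S / OPT n \<alpha> \<le> ereal (6 * \<alpha> * n) / OPT n \<alpha>"
    using social_cost_le by (rule ereal_divide_right_mono) (rule optpos)
  also have "\<dots> \<le> ereal (6 * \<alpha> * n) / ereal (\<alpha> * (real n - 1))"
    using opt pos \<alpha> by (intro ereal_divide_left_mono) (use n optpos in \<open>auto simp: ereal_zero_less_0_iff\<close>)
  also have "\<dots> = ereal (6 * n / (real n - 1))"
    using \<alpha> n by simp
  \<comment> \<open>The left side equals 6 + 6/(n - 1), so the constant 10 leaves slack.\<close>
  also have "\<dots> \<le> ereal (10 + 10 / (real n - 1))"
    using n by (simp add: field_simps)
  finally show ?thesis .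
qed

end

theorem mainTheorem3:
  "(\<forall>n::nat. \<forall>\<alpha>::real. n \<ge> 3 \<and> \<alpha> > 0 \<longrightarrow>
      (\<forall>S. nash_equilibrium n \<alpha> S \<and> essential S \<longrightarrow>
         social_cost n \<alpha> S / OPT n \<alpha> \<le> ereal (10 + 10 / (real n - 1))) \<and>
      price_of_anarchy n \<alpha> \<le> ereal (10 + 10 / (real n - 1))) \<and>
   (\<lambda>n::nat. (10 + 10 / (real n - 1)) - 10 :: real) \<in> o(\<lambda>n. 1)"
proof (intro conjI allI impI)
  fix n :: nat and \<alpha> :: real and S
  assume "n \<ge> 3 \<and> \<alpha> > 0" "nash_equilibrium n \<alpha> S \<and> essential S"
  then show "social_cost n \<alpha> S / OPT n \<alpha> \<le> ereal (10 + 10 / (real n - 1))"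
    by (intro equilibrium.cost_ratio_le equilibrium.intro) auto
next
  fix n :: nat and \<alpha> :: real
  assume "n \<ge> 3 \<and> \<alpha> > 0"
  then show "price_of_anarchy n \<alpha> \<le> ereal (10 + 10 / (real n - 1))"
    unfolding price_of_anarchy_def
    by (intro SUP_least equilibrium.cost_ratio_le equilibrium.intro) auto
next
  have "(\<lambda>n. 10 * inverse (real n - 1)) \<longlonglongrightarrow> 10 * 0"
    by (intro tendsto_intros tendsto_inverse_0_at_top
        filterlim_tendsto_add_at_top[of "\<lambda>_. -1" "-1", simplified] filterlim_real_sequentially)
  then show "(\<lambda>n::nat. (10 + 10 / (real n - 1)) - 10 :: real) \<in> o(\<lambda>n. 1)"
    by (intro smalloI_tendsto) (auto simp: divide_inverse)
qed

end
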